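(* Let $p$ be a prime, $d\ge1$, let $f:\mathbb{Z}_p^d\to\mathbb{Z}_p^d$ be a polynomial map, and let $x_0\in\mathbb{Z}_p^d$ be arbitrary. Let $E=\overline{\{f^{j}(x_0): j\ge0\}}$ be the closure of the orbit of $x_0$. Then (the box dimension of $E$ exists and) $$\dim_B(E)\in\{0,1\}.$$
   Context: A polynomial map $f:\mathbb{Z}_p^d\to\mathbb{Z}_p^d$ is a map $f=(f_1,\dots,f_d)$ where each $f_j$ is given by a polynomial in $\mathbb{Z}_p[X_1,\dots,X_d]$. $f^{j}$ denotes the $j$-th iterate. For $n\ge 1$, $\pi_n:\mathbb{Z}_p^d\to(\mathbb{Z}/p^n\mathbb{Z})^d$ is reduction modulo $p^n$. For $E\subseteq\mathbb{Z}_p^d$, the box dimension is $\dim_B(E)=\lim_{n\to\infty}\frac{\log|\pi_n(E)|}{n\log p}$, whenever this limit exists. *)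

theory Defs
  imports
    "HOL-Analysis.Analysis"
    "HOL-Library.Poly_Mapping"
    "Berlekamp_Zassenhaus.Finite_Field"
begin

section \<open>The ring of p-adic integers\<close>

text \<open>
  The prime is \<open>p = CARD('p)\<close> for a type \<open>'p\<close> of class \<open>prime_card\<close>. A p-adic integer is an
  element of the inverse limit of the rings of integers modulo \<open>p ^ n\<close>, i.e. a compatible
  sequence of residues, the residue modulo \<open>p ^ n\<close> being represented in \<open>{0..<p ^ n}\<close>.
\<close>

abbreviation pp :: "'p::prime_card itself \<Rightarrow> nat \<Rightarrow> int" where
  "pp _ n \<equiv> int CARD('p) ^ n"

typedef (overloaded) 'p padic_int =
  "{x :: nat \<Rightarrow> int. \<forall>n. x n \<in> {0..<pp TYPE('p::prime_card) n} \<and>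
                          x (Suc n) mod pp TYPE('p) n = x n}"
  morphisms padic_residue Abs_padic_int
proof -
  have "int CARD('p) > 0" by simp
  then show ?thesis by (intro exI[of _ "\<lambda>_. 0"]) simp
qed

setup_lifting type_definition_padic_int

lemma pp_pos: "pp TYPE('p::prime_card) n > 0"
  by simp

lemma mod_pp_Suc: "(a mod pp TYPE('p::prime_card) (Suc n)) mod pp TYPE('p) n = a mod pp TYPE('p) n"
  by (rule mod_mod_cancel) simp

lemma padic_residue_range: "0 \<le> padic_residue (x :: 'p::prime_card padic_int) n" "padic_residue x n < pp TYPE('p) n"
  using padic_residue[of x] by auto

lemma padic_residue_Suc_mod:
  "padic_residue (x :: 'p::prime_card padic_int) (Suc n) mod pp TYPE('p) n = padic_residue x n"
  using padic_residue[of x] by auto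

lemma padic_int_eqI: "(\<And>n. padic_residue x n = padic_residue y n) \<Longrightarrow> x = y"
  by (metis padic_residue_inject ext)

instantiation padic_int :: (prime_card) comm_ring_1
begin

lift_definition zero_padic_int :: "'a padic_int" is "\<lambda>_. 0"
  by simp

lift_definition one_padic_int :: "'a padic_int" is "\<lambda>n. 1 mod pp TYPE('a) n"
  by (auto simp del: power_Suc simp add: mod_pp_Suc)

lift_definition plus_padic_int :: "'a padic_int \<Rightarrow> 'a padic_int \<Rightarrow> 'a padic_int"
  is "\<lambda>x y n. (x n + y n) mod pp TYPE('a) n"
  by (auto simp del: power_Suc simp add: mod_pp_Suc) (metis mod_add_eq)

lift_definition uminus_padic_int :: "'a padic_int \<Rightarrow> 'a padic_int"
  is "\<lambda>x n. (- x n) mod pp TYPE('a) n"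
  by (auto simp del: power_Suc simp add: mod_pp_Suc) (metis mod_minus_eq)

lift_definition minus_padic_int :: "'a padic_int \<Rightarrow> 'a padic_int \<Rightarrow> 'a padic_int"
  is "\<lambda>x y n. (x n - y n) mod pp TYPE('a) n"
  by (auto simp del: power_Suc simp add: mod_pp_Suc) (metis mod_diff_eq)

lift_definition times_padic_int :: "'a padic_int \<Rightarrow> 'a padic_int \<Rightarrow> 'a padic_int"
  is "\<lambda>x y n. (x n * y n) mod pp TYPE('a) n"
  by (auto simp del: power_Suc simp add: mod_pp_Suc) (metis mod_mult_eq)

instance
proof
  fix a b c :: "'a padic_int"
  show "a * b * c = a * (b * c)"
    by transfer (simp add: mod_simps ac_simps)
  show "a * b = b * a"
    by transfer (simp add: ac_simps)
  show "1 * a = a"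
    by transfer (auto simp: mod_simps)
  show "a + b + c = a + (b + c)"
    by transfer (simp add: mod_simps ac_simps)
  show "a + b = b + a"
    by transfer (simp add: ac_simps)
  show "0 + a = a"
    by transfer auto
  show "- a + a = 0"
    by transfer (simp add: mod_simps)
  show "a - b = a + - b"
    by transfer (simp add: mod_simps)
  show "(a + b) * c = a * c + b * c"
    by transfer (simp add: mod_simps algebra_simps)
  show "(0 :: 'a padic_int) \<noteq> 1"
  proof
    assume "(0 :: 'a padic_int) = 1"
    then have "padic_residue (0 :: 'a padic_int) 1 = padic_residue 1 1" by simp
    moreover have "int CARD('a) > 1"
      using prime_gt_1_nat[OF prime_card[where 'a = 'a]] by simp
    ultimately show False
      by (simp add: zero_padic_int.rep_eq one_padic_int.rep_eq)
  qed
qed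

end

lemma padic_residue_ring_simps:
  fixes x y :: "'p::prime_card padic_int"
  shows "padic_residue (0 :: 'p padic_int) n = 0"
    and "padic_residue (1 :: 'p padic_int) n = 1 mod pp TYPE('p) n"
    and "padic_residue (x + y) n = (padic_residue x n + padic_residue y n) mod pp TYPE('p) n"
    and "padic_residue (- x) n = (- padic_residue x n) mod pp TYPE('p) n"
    and "padic_residue (x - y) n = (padic_residue x n - padic_residue y n) mod pp TYPE('p) n"
    and "padic_residue (x * y) n = (padic_residue x n * padic_residue y n) mod pp TYPE('p) n"
  by (simp_all add: zero_padic_int.rep_eq one_padic_int.rep_eq plus_padic_int.rep_eq
      uminus_padic_int.rep_eq minus_padic_int.rep_eq times_padic_int.rep_eq)

section \<open>The p-adic metric\<close>

text \<open>For \<open>x \<noteq> 0\<close> the valuation is the largest \<open>n\<close> such that \<open>p ^ n\<close> divides \<open>x\<close>, which is the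
  predecessor of the first level with nonzero residue. The value at 0 is irrelevant.\<close>

definition padic_val :: "'p::prime_card padic_int \<Rightarrow> nat" where
  "padic_val x = (LEAST n. padic_residue x (Suc n) \<noteq> 0)"

definition padic_abs :: "'p::prime_card padic_int \<Rightarrow> real" where
  "padic_abs x = (if x = 0 then 0 else inverse (real CARD('p) ^ padic_val x))"

lemma padic_residue_eq_0_mono:
  fixes x :: "'p::prime_card padic_int"
  assumes "m \<le> n" "padic_residue x n = 0"
  shows "padic_residue x m = 0"
  using assms
proof (induction n rule: dec_induct)
  case (step n)
  then show ?case using padic_residue_Suc_mod[of x n] by simp
qed simp

lemma padic_residue_0_level: "padic_residue (x :: 'p::prime_card padic_int) 0 = 0"
  using padic_residue_range[of x 0] by simp

lemma padic_residue_eq_0_iff: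
  fixes x :: "'p::prime_card padic_int"
  assumes "x \<noteq> 0"
  shows "padic_residue x n = 0 \<longleftrightarrow> n \<le> padic_val x"
proof -
  obtain k where k: "padic_residue x k \<noteq> 0"
    using assms padic_int_eqI[of x 0] by (auto simp: padic_residue_ring_simps)
  then obtain j where j: "k = Suc j"
    using padic_residue_0_level[of x] by (cases k) auto
  have nz: "padic_residue x (Suc (padic_val x)) \<noteq> 0"
    unfolding padic_val_def by (rule LeastI[of _ j]) (use k j in simp)
  have z: "padic_residue x (padic_val x) = 0"
  proof (cases "padic_val x")
    case 0
    then show ?thesis by (simp add: padic_residue_0_level)
  next
    case (Suc m)
    then show ?thesis
      using not_less_Least[of m "\<lambda>n. padic_residue x (Suc n) \<noteq> 0"] unfolding padic_val_def by auto
  qed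
  show ?thesis
    using nz z padic_residue_eq_0_mono[of n "padic_val x" x] padic_residue_eq_0_mono[of "Suc (padic_val x)" n x]
    by (meson not_less_eq_eq)
qed

lemma CARD_gt_1: "real CARD('p::prime_card) > 1"
  using prime_gt_1_nat[OF prime_card[where 'a = 'p]] by simp

lemma padic_abs_nonneg: "padic_abs x \<ge> 0"
  by (simp add: padic_abs_def)

lemma padic_abs_le_iff:
  fixes x :: "'p::prime_card padic_int"
  shows "padic_abs x \<le> inverse (real CARD('p) ^ n) \<longleftrightarrow> padic_residue x n = 0"
proof (cases "x = 0")
  case True
  then show ?thesis by (simp add: padic_abs_def padic_residue_ring_simps)
next
  case False
  have "padic_abs x \<le> inverse (real CARD('p) ^ n) \<longleftrightarrow> n \<le> padic_val x"
    using False CARD_gt_1[where 'p = 'p] by (simp add: padic_abs_def)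
  then show ?thesis using padic_residue_eq_0_iff[OF False] by simp
qed

lemma padic_abs_minus: "padic_abs (- x) = padic_abs (x :: 'p::prime_card padic_int)"
proof -
  have "padic_residue (- x) n = 0 \<longleftrightarrow> padic_residue x n = 0" for n
  proof -
    have "padic_residue x n = 0 \<longleftrightarrow> padic_residue x n mod pp TYPE('p) n = 0"
      using padic_residue_range[of x n] by simp
    then show ?thesis
      by (simp only: padic_residue_ring_simps mod_0_imp_dvd dvd_eq_mod_eq_0[symmetric] dvd_minus_iff)
  qed
  then show ?thesis by (simp add: padic_abs_def padic_val_def)
qed

lemma padic_abs_add:
  fixes x y :: "'p::prime_card padic_int"
  shows "padic_abs (x + y) \<le> max (padic_abs x) (padic_abs y)"
proof (cases "x = 0 \<or> y = 0")
  case True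
  then show ?thesis by auto
next
  case False
  define n where "n = min (padic_val x) (padic_val y)"
  have "padic_residue x n = 0" "padic_residue y n = 0"
    using False by (simp_all add: padic_residue_eq_0_iff n_def)
  then have "padic_abs (x + y) \<le> inverse (real CARD('p) ^ n)"
    by (simp add: padic_abs_le_iff padic_residue_ring_simps)
  also have "\<dots> \<le> max (padic_abs x) (padic_abs y)"
    using False by (auto simp: padic_abs_def n_def min_def)
  finally show ?thesis .
qed

instantiation padic_int :: (prime_card) metric_space
begin

definition dist_padic_int :: "'a padic_int \<Rightarrow> 'a padic_int \<Rightarrow> real" where
  "dist_padic_int x y = padic_abs (x - y)"

definition uniformity_padic_int :: "('a padic_int \<times> 'a padic_int) filter" where
  "uniformity_padic_int = (INF e\<in>{0<..}. principal {(x, y). dist x y < e})"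

definition open_padic_int :: "'a padic_int set \<Rightarrow> bool" where
  "open_padic_int U \<longleftrightarrow> (\<forall>x\<in>U. eventually (\<lambda>(x', y). x' = x \<longrightarrow> y \<in> U) uniformity)"

instance
proof
  fix x y z :: "'a padic_int"
  show "dist x y = 0 \<longleftrightarrow> x = y"
    by (simp add: dist_padic_int_def padic_abs_def)
  have "padic_abs (x - y) \<le> max (padic_abs (x - z)) (padic_abs (- (y - z)))"
    using padic_abs_add[of "x - z" "- (y - z)"] by simp
  then show "dist x y \<le> dist x z + dist y z"
    unfolding dist_padic_int_def padic_abs_minus
    using padic_abs_nonneg[of "x - z"] padic_abs_nonneg[of "y - z"] by linarith
qed (simp_all add: uniformity_padic_int_def open_padic_int_def)

end

section \<open>Polynomial maps\<close>

text \<open>A polynomial in the variables indexed by \<open>'d\<close> with coefficients in \<open>'a\<close> is a finitely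
  supported function from monomials (exponent vectors) to coefficients.\<close>

type_synonym ('d, 'a) mpoly = "('d \<Rightarrow>\<^sub>0 nat) \<Rightarrow>\<^sub>0 'a"

definition mpoly_eval :: "('d::finite, 'a::comm_ring_1) mpoly \<Rightarrow> 'a ^ 'd \<Rightarrow> 'a" where
  "mpoly_eval P x =
    (\<Sum>m\<in>Poly_Mapping.keys P. Poly_Mapping.lookup P m *
      (\<Prod>i\<in>UNIV. (x $ i) ^ Poly_Mapping.lookup m i))"

definition polynomial_map :: "('a::comm_ring_1 ^ 'd::finite \<Rightarrow> 'a ^ 'd) \<Rightarrow> bool" where
  "polynomial_map f \<longleftrightarrow> (\<exists>P :: 'd \<Rightarrow> ('d, 'a) mpoly. \<forall>x j. f x $ j = mpoly_eval (P j) x)"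

section \<open>Box dimension\<close>

text \<open>Reduction modulo \<open>p ^ n\<close>; the target is represented by vectors with entries in \<open>{0..<p ^ n}\<close>.\<close>

definition padic_reduce :: "nat \<Rightarrow> 'p::prime_card padic_int ^ 'd \<Rightarrow> int ^ 'd" where
  "padic_reduce n x = (\<chi> i. padic_residue (x $ i) n)"

definition box_quotient :: "('p::prime_card padic_int ^ 'd) set \<Rightarrow> nat \<Rightarrow> real" where
  "box_quotient E n = ln (real (card (padic_reduce n ` E))) / (real n * ln (real CARD('p)))"

definition box_dim_exists :: "('p::prime_card padic_int ^ 'd) set \<Rightarrow> bool" where
  "box_dim_exists E \<longleftrightarrow> convergent (box_quotient E)"

definition box_dim :: "('p::prime_card padic_int ^ 'd) set \<Rightarrow> real" where
  "box_dim E = lim (box_quotient E)"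

end

theory Submission
  imports Defs "HOL-Real_Asymp.Real_Asymp"
begin

text \<open>
  Reductions of \<open>E\<close> and of the orbit agree, so everything depends on the growth of the number
  \<open>N n\<close> of orbit points modulo \<open>p ^ n\<close>. The proof shows that this number grows either at most linearly
  in \<open>n\<close> or like \<open>p ^ n\<close> up to a polynomial factor; nothing in between can occur.

  A finite semigroup contains an idempotent, so some iterate \<open>F = f ^^ k\<close> satisfies
  \<open>F (F x) \<equiv> F x\<close> modulo \<open>p ^ 4\<close> for all \<open>x\<close> (\<open>exists_idempotent_iterate\<close>). The power 4 is twice 2:
  with \<open>x1 = F x0\<close> and \<open>D\<close> the derivative of \<open>F\<close> at \<open>x1\<close>, comparing first-order terms in
  \<open>F (F (x1 + p\<^sup>2 h))\<close> gives both \<open>F x1 \<equiv> x1\<close> and \<open>D\<^sup>2 \<equiv> D\<close> modulo \<open>p\<^sup>2\<close>. Hence every iterate \<open>F ^^ c\<close>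
  with \<open>c > 0\<close> has the same derivative \<open>D\<close> modulo \<open>p\<^sup>2\<close> at all points of the residue class of \<open>x1\<close>.

  Suppose \<open>(F ^^ c) x = x + p ^ n a\<close> with \<open>n \<ge> 2\<close>, and put \<open>y = (F ^^ c) x\<close> and \<open>b = D a\<close>. Because \<open>D\<close> is
  idempotent, the component of \<open>a\<close> in its kernel dies after one step and the remaining motion is a
  uniform translation: \<open>(F ^^ (i * c)) y \<equiv> y + p ^ n i b\<close> modulo \<open>p ^ (n + 2)\<close> (\<open>drift_start\<close>).
  Two levels of precision are exactly what is needed to pass from one level to the next. If
  \<open>b \<equiv> 0\<close> modulo \<open>p\<close>, then \<open>c\<close> is still a period modulo \<open>p ^ (n + 1)\<close>. If not, the period becomes
  \<open>p c\<close>, and taking \<open>i = p\<close> shows that the translation vector at the next level is congruent to \<open>b\<close> modulo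
  \<open>p\<close>, hence again nonzero (\<open>drift_lift\<close>). So once the period has grown, it grows by the factor \<open>p\<close> at
  every later level.

  Either the period under \<open>F\<close> stays 1 at all levels, each level adding at most one point to the
  preperiod, or from some level \<open>n0\<close> on it equals \<open>p ^ (n - n0)\<close>, and the preperiod is bounded, up to
  a constant, by the sum of the periods so far. This is \<open>orbit_count_dichotomy\<close>, and the two cases have dimension 0 and 1.
\<close>

section \<open>Congruences modulo powers of p\<close>

abbreviation pz :: "'p::prime_card padic_int" where
  "pz \<equiv> of_nat CARD('p)"

lemma padic_residue_mod_le:
  fixes x :: "'p::prime_card padic_int"
  assumes "m \<le> n"
  shows "padic_residue x n mod pp TYPE('p) m = padic_residue x m"
  using assms
proof (induction n rule: dec_induct)
  case base
  then show ?case using padic_residue_range[of x m] by simp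
next
  case (step n)
  have "padic_residue x (Suc n) mod pp TYPE('p) m
      = padic_residue x (Suc n) mod pp TYPE('p) n mod pp TYPE('p) m"
    using step.hyps by (intro mod_mod_cancel[symmetric] le_imp_power_dvd) simp
  then show ?case using step.IH padic_residue_Suc_mod[of x n] by simp
qed

lemma padic_residue_of_nat: "padic_residue (of_nat k :: 'p::prime_card padic_int) n = int k mod pp TYPE('p) n"
  by (induction k) (simp_all add: padic_residue_ring_simps mod_simps)

lemma padic_residue_pz_power_mult:
  fixes x :: "'p::prime_card padic_int"
  shows "padic_residue (pz ^ m * x) (m + n) = pp TYPE('p) m * padic_residue x n"
proof -
  have "padic_residue (pz ^ m * x) (m + n)
      = (pp TYPE('p) m * padic_residue x (m + n)) mod (pp TYPE('p) m * pp TYPE('p) n)"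
    using padic_residue_of_nat[of "CARD('p) ^ m" "m + n", where 'p = 'p]
    by (simp add: padic_residue_ring_simps mod_simps power_add)
  also have "\<dots> = pp TYPE('p) m * padic_residue x n"
    using padic_residue_mod_le[of n "m + n" x] by (simp add: mult_mod_right[symmetric])
  finally show ?thesis .
qed

text \<open>
  The quotient by \<open>p ^ n\<close> is obtained by dropping the first \<open>n\<close> digits, that is, by shifting the
  sequence of residues. Divisibility makes it possible to use ring arithmetic in place of residues.
\<close>

lemma padic_residue_eq_0_iff_dvd:
  fixes x :: "'p::prime_card padic_int"
  shows "padic_residue x n = 0 \<longleftrightarrow> pz ^ n dvd x"
proof
  assume "pz ^ n dvd x"
  then obtain y where "x = pz ^ n * y" ..
  then show "padic_residue x n = 0"
    using padic_residue_pz_power_mult[of n y 0] padic_residue_0_level[of y] by simp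
next
  assume 0: "padic_residue x n = 0"
  define u where "u = (\<lambda>m. padic_residue x (n + m) div pp TYPE('p) n)"
  have u: "padic_residue x (n + m) = pp TYPE('p) n * u m" for m
    using padic_residue_mod_le[of n "n + m" x] 0 by (auto simp: u_def)
  have "u m \<in> {0..<pp TYPE('p) m}" for m
  proof -
    have "0 \<le> pp TYPE('p) n * u m" "pp TYPE('p) n * u m < pp TYPE('p) n * pp TYPE('p) m"
      using padic_residue_range[of x "n + m"] u[of m] by (simp_all add: power_add)
    then show ?thesis
      using pp_pos[of n, where 'p = 'p] by (simp add: zero_le_mult_iff)
  qed
  moreover have "u (Suc m) mod pp TYPE('p) m = u m" for m
  proof -
    have "pp TYPE('p) n * (u (Suc m) mod pp TYPE('p) m)
        = padic_residue x (Suc (n + m)) mod pp TYPE('p) (n + m)"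
      using u[of "Suc m"] by (simp add: power_add)
    also have "\<dots> = pp TYPE('p) n * u m"
      using padic_residue_Suc_mod[of x "n + m"] u[of m] by simp
    finally show ?thesis by simp
  qed
  ultimately have res: "padic_residue (Abs_padic_int u :: 'p padic_int) = u"
    by (intro Abs_padic_int_inverse) simp
  have "x = pz ^ n * Abs_padic_int u"
  proof (rule padic_int_eqI)
    fix m
    have "padic_residue (pz ^ n * Abs_padic_int u :: 'p padic_int) (n + m) = padic_residue x (n + m)"
      using padic_residue_pz_power_mult[of n "Abs_padic_int u :: 'p padic_int" m] res u[of m] by simp
    then show "padic_residue x m = padic_residue (pz ^ n * Abs_padic_int u :: 'p padic_int) m"
      using padic_residue_mod_le[of m "n + m"] by (metis le_add2)
  qed
  then show "pz ^ n dvd x" by simp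
qed

lemma padic_residue_eq_iff_dvd:
  fixes x y :: "'p::prime_card padic_int"
  shows "padic_residue x n = padic_residue y n \<longleftrightarrow> pz ^ n dvd x - y"
proof -
  have "padic_residue x n = padic_residue y n
      \<longleftrightarrow> padic_residue x n mod pp TYPE('p) n = padic_residue y n mod pp TYPE('p) n"
    using padic_residue_range[of x n] padic_residue_range[of y n] by simp
  also have "\<dots> \<longleftrightarrow> padic_residue (x - y) n = 0"
    by (simp add: padic_residue_ring_simps mod_eq_dvd_iff dvd_eq_mod_eq_0)
  finally show ?thesis by (simp add: padic_residue_eq_0_iff_dvd)
qed

lemma pz_dvd_of_nat_mult:
  fixes c :: "'p::prime_card padic_int"
  assumes "pz dvd of_nat l * c" "\<not> pz dvd c"
  shows "CARD('p) dvd l"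
proof -
  have "(int l * padic_residue c 1) mod int CARD('p) = 0"
    using assms(1) padic_residue_eq_0_iff_dvd[of "of_nat l * c" 1]
    by (simp add: padic_residue_ring_simps padic_residue_of_nat mod_simps)
  then have "int CARD('p) dvd int l * padic_residue c 1" by (rule mod_0_imp_dvd)
  moreover have "prime (int CARD('p))" using prime_card[where 'a = 'p] by simp
  ultimately have "int CARD('p) dvd int l \<or> int CARD('p) dvd padic_residue c 1"
    by (simp add: prime_dvd_mult_iff)
  moreover have "\<not> int CARD('p) dvd padic_residue c 1"
  proof
    assume "int CARD('p) dvd padic_residue c 1"
    then have "padic_residue c 1 = 0"
      using padic_residue_range[of c 1] zdvd_not_zless[of "padic_residue c 1" "int CARD('p)"]
      by (cases "padic_residue c 1 = 0") auto
    then show False using assms(2) padic_residue_eq_0_iff_dvd[of c 1] by simp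
  qed
  ultimately show ?thesis by simp
qed

definition pcong :: "nat \<Rightarrow> 'p::prime_card padic_int ^ 'd \<Rightarrow> 'p padic_int ^ 'd \<Rightarrow> bool" where
  "pcong n x y \<longleftrightarrow> padic_reduce n x = padic_reduce n y"

lemma pcong_refl [simp]: "pcong n x x"
  by (simp add: pcong_def)

lemma pcong_sym: "pcong n x y \<Longrightarrow> pcong n y x"
  by (simp add: pcong_def)

lemma pcong_trans [trans]: "pcong n x y \<Longrightarrow> pcong n y z \<Longrightarrow> pcong n x z"
  by (simp add: pcong_def)

lemma pcong_iff_dvd:
  fixes x y :: "'p::prime_card padic_int ^ 'd"
  shows "pcong n x y \<longleftrightarrow> (\<forall>i. pz ^ n dvd x $ i - y $ i)"
  by (simp add: pcong_def padic_reduce_def vec_eq_iff padic_residue_eq_iff_dvd)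

lemma pcong_iff_ex:
  fixes x y :: "'p::prime_card padic_int ^ 'd"
  shows "pcong n x y \<longleftrightarrow> (\<exists>r. x = y + pz ^ n *s r)"
proof
  assume "pcong n x y"
  then have "\<forall>i. \<exists>r. x $ i - y $ i = pz ^ n * r"
    by (auto simp: pcong_iff_dvd dvd_def)
  then obtain r where "\<And>i. x $ i - y $ i = pz ^ n * r i" by metis
  then have "x = y + pz ^ n *s (\<chi> i. r i)"
    by (simp add: vec_eq_iff algebra_simps)
  then show "\<exists>r. x = y + pz ^ n *s r" ..
qed (auto simp: pcong_iff_dvd)

lemma pcong_mono: "pcong n x y \<Longrightarrow> m \<le> n \<Longrightarrow> pcong m x y"
  unfolding pcong_iff_dvd by (meson dvd_trans le_imp_power_dvd)

lemma pcong_add: "pcong n x y \<Longrightarrow> pcong n u v \<Longrightarrow> pcong n (x + u) (y + v)"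
  unfolding pcong_iff_dvd vector_add_component add_diff_add by (blast intro: dvd_add)

text \<open>
  Cancelling \<open>p ^ m\<close> lowers the modulus by the same power. This turns a congruence between two
  perturbations of \<open>z\<close> into one between their directions.
\<close>

lemma pcong_scaled:
  fixes x y :: "'p::prime_card padic_int ^ 'd"
  shows "pcong (m + n) (z + pz ^ m *s x) (z + pz ^ m *s y) \<longleftrightarrow> pcong n x y"
proof -
  have "pz ^ (m + n) dvd pz ^ m * w \<longleftrightarrow> pz ^ n dvd w" for w :: "'p padic_int"
    by (simp add: padic_residue_eq_0_iff_dvd[symmetric] padic_residue_pz_power_mult)
  then show ?thesis
    by (simp add: pcong_iff_dvd right_diff_distrib[symmetric])
qed

lemma pcong_scale: "pcong n x y \<Longrightarrow> pcong n (c *s x) (c *s y)"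
  by (auto simp: pcong_iff_dvd right_diff_distrib[symmetric])

lemma matrix_vector_scale: "D *v (c *s x) = c *s (D *v x)"
  for D :: "'a::comm_semiring_1 ^ 'd ^ 'e"
  by (simp add: vec_eq_iff matrix_vector_mult_def sum_distrib_left mult.left_commute)

lemma pcong_matrix_vector_mult:
  assumes "pcong n x y"
  shows "pcong n (D *v x) (D *v y)"
proof -
  obtain r where "x = y + pz ^ n *s r" using assms pcong_iff_ex by blast
  then have "D *v x = D *v y + pz ^ n *s (D *v r)"
    by (simp add: matrix_vector_right_distrib matrix_vector_scale)
  then show ?thesis using pcong_iff_ex by blast
qed

section \<open>First-order expansion of polynomial maps\<close>

text \<open>
  The class of functions with a first-order expansion is closed under sums and products, so it
  contains all polynomial functions without recourse to formal partial derivatives.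
  The remainder has to be divisible by \<open>t\<^sup>2\<close> uniformly in the direction \<open>h\<close>.
\<close>

definition taylor_fun :: "('a::comm_ring_1 ^ 'd::finite \<Rightarrow> 'a) \<Rightarrow> bool" where
  "taylor_fun g \<longleftrightarrow> (\<forall>x. \<exists>v. \<forall>t h. t\<^sup>2 dvd g (x + t *s h) - g x - t * (\<Sum>i\<in>UNIV. v $ i * h $ i))"

lemma taylor_fun_const: "taylor_fun (\<lambda>x. c)"
  unfolding taylor_fun_def by (intro allI exI[of _ 0]) simp

lemma taylor_fun_nth: "taylor_fun (\<lambda>x. x $ j)"
  unfolding taylor_fun_def
proof (intro allI exI[of _ "axis j 1"])
  fix x h :: "'a ^ 'b" and t :: 'a
  have "(\<Sum>i\<in>UNIV. axis j 1 $ i * h $ i) = h $ j"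
    by (simp add: axis_def if_distrib[of "\<lambda>a. a * _"] cong: if_cong)
  then show "t\<^sup>2 dvd (x + t *s h) $ j - x $ j - t * (\<Sum>i\<in>UNIV. axis j 1 $ i * h $ i)" by simp
qed

lemma taylor_fun_add:
  assumes "taylor_fun g" "taylor_fun k"
  shows "taylor_fun (\<lambda>x. g x + k x)"
  unfolding taylor_fun_def
proof
  fix x
  obtain v where v: "\<And>t h. t\<^sup>2 dvd g (x + t *s h) - g x - t * (\<Sum>i\<in>UNIV. v $ i * h $ i)"
    using assms(1) unfolding taylor_fun_def by blast
  obtain w where w: "\<And>t h. t\<^sup>2 dvd k (x + t *s h) - k x - t * (\<Sum>i\<in>UNIV. w $ i * h $ i)"
    using assms(2) unfolding taylor_fun_def by blast
  show "\<exists>v. \<forall>t h. t\<^sup>2 dvd g (x + t *s h) + k (x + t *s h) - (g x + k x) - t * (\<Sum>i\<in>UNIV. v $ i * h $ i)"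
  proof (intro exI[of _ "v + w"] allI)
    fix t h
    show "t\<^sup>2 dvd g (x + t *s h) + k (x + t *s h) - (g x + k x) - t * (\<Sum>i\<in>UNIV. (v + w) $ i * h $ i)"
      using dvd_add[OF v[of t h] w[of t h]] by (simp add: algebra_simps sum.distrib)
  qed
qed

lemma taylor_fun_mult:
  assumes "taylor_fun g" "taylor_fun k"
  shows "taylor_fun (\<lambda>x. g x * k x)"
  unfolding taylor_fun_def
proof
  fix x
  obtain v where v: "\<And>t h. t\<^sup>2 dvd g (x + t *s h) - g x - t * (\<Sum>i\<in>UNIV. v $ i * h $ i)"
    using assms(1) unfolding taylor_fun_def by blast
  obtain w where w: "\<And>t h. t\<^sup>2 dvd k (x + t *s h) - k x - t * (\<Sum>i\<in>UNIV. w $ i * h $ i)"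
    using assms(2) unfolding taylor_fun_def by blast
  show "\<exists>v. \<forall>t h. t\<^sup>2 dvd g (x + t *s h) * k (x + t *s h) - g x * k x - t * (\<Sum>i\<in>UNIV. v $ i * h $ i)"
  proof (intro exI[of _ "k x *s v + g x *s w"] allI)
    fix t h
    define V where "V = (\<Sum>i\<in>UNIV. v $ i * h $ i)"
    define W where "W = (\<Sum>i\<in>UNIV. w $ i * h $ i)"
    obtain r where "g (x + t *s h) - g x - t * V = t\<^sup>2 * r" using v[of t h] unfolding V_def ..
    then have r: "g (x + t *s h) = g x + t * V + t\<^sup>2 * r" by (simp add: algebra_simps)
    obtain s where "k (x + t *s h) - k x - t * W = t\<^sup>2 * s" using w[of t h] unfolding W_def ..
    then have s: "k (x + t *s h) = k x + t * W + t\<^sup>2 * s" by (simp add: algebra_simps)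
    have "(\<Sum>i\<in>UNIV. (k x *s v + g x *s w) $ i * h $ i) = k x * V + g x * W"
      by (simp add: V_def W_def sum_distrib_left sum.distrib algebra_simps)
    then have "g (x + t *s h) * k (x + t *s h) - g x * k x
          - t * (\<Sum>i\<in>UNIV. (k x *s v + g x *s w) $ i * h $ i)
        = t\<^sup>2 * (V * W + g x * s + r * k x + t * V * s + t * r * W + t\<^sup>2 * r * s)"
      unfolding r s by (simp add: algebra_simps power2_eq_square)
    then show "t\<^sup>2 dvd g (x + t *s h) * k (x + t *s h) - g x * k x
          - t * (\<Sum>i\<in>UNIV. (k x *s v + g x *s w) $ i * h $ i)" by simp
  qed
qed

lemma taylor_fun_sum: "(\<And>a. a \<in> A \<Longrightarrow> taylor_fun (g a)) \<Longrightarrow> taylor_fun (\<lambda>x. \<Sum>a\<in>A. g a x)"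
  by (induction A rule: infinite_finite_induct) (simp_all add: taylor_fun_const taylor_fun_add)

lemma taylor_fun_prod: "(\<And>a. a \<in> A \<Longrightarrow> taylor_fun (g a)) \<Longrightarrow> taylor_fun (\<lambda>x. \<Prod>a\<in>A. g a x)"
  by (induction A rule: infinite_finite_induct) (simp_all add: taylor_fun_const taylor_fun_mult)

lemma taylor_fun_power: "taylor_fun g \<Longrightarrow> taylor_fun (\<lambda>x. g x ^ n)"
  by (induction n) (simp_all add: taylor_fun_const taylor_fun_mult)

lemma taylor_fun_mpoly_eval: "taylor_fun (mpoly_eval P)"
proof -
  have "taylor_fun (\<lambda>x. mpoly_eval P x)"
    unfolding mpoly_eval_def
    by (rule taylor_fun_sum, rule taylor_fun_mult, rule taylor_fun_const, rule taylor_fun_prod,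
        rule taylor_fun_power, rule taylor_fun_nth)
  then show ?thesis by simp
qed

definition taylor_at ::
  "('p::prime_card padic_int ^ 'd::finite \<Rightarrow> 'p padic_int ^ 'd) \<Rightarrow> 'p padic_int ^ 'd
    \<Rightarrow> 'p padic_int ^ 'd ^ 'd \<Rightarrow> bool" where
  "taylor_at f x D \<longleftrightarrow> (\<forall>n h. pcong (2 * n) (f (x + pz ^ n *s h)) (f x + pz ^ n *s (D *v h)))"

lemma polynomial_map_taylor_at:
  assumes "polynomial_map f"
  shows "\<exists>D. taylor_at f x D"
proof -
  obtain P where P: "\<And>x j. f x $ j = mpoly_eval (P j) x"
    using assms unfolding polynomial_map_def by blast
  have "\<forall>j. \<exists>v. \<forall>t h. t\<^sup>2 dvd f (x + t *s h) $ j - f x $ j - t * (\<Sum>i\<in>UNIV. v $ i * h $ i)"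
    using taylor_fun_mpoly_eval unfolding taylor_fun_def P by blast
  then obtain D where D: "\<And>j t h. t\<^sup>2 dvd f (x + t *s h) $ j - f x $ j - t * (\<Sum>i\<in>UNIV. D j $ i * h $ i)"
    by metis
  have "taylor_at f x (\<chi> j. D j)"
    unfolding taylor_at_def pcong_iff_dvd
  proof (intro allI)
    fix n h j
    show "pz ^ (2 * n) dvd f (x + pz ^ n *s h) $ j - (f x + pz ^ n *s ((\<chi> j. D j) *v h)) $ j"
      using D[of "pz ^ n" h j]
      by (simp add: matrix_vector_mult_def power_mult[symmetric] mult.commute diff_diff_eq)
  qed
  then show ?thesis ..
qed

lemma taylor_at_pcong:
  assumes "taylor_at f y D" "pcong n x y"
  shows "pcong n (f x) (f y)"
proof -
  obtain h where h: "x = y + pz ^ n *s h" using assms(2) pcong_iff_ex by blast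
  have "pcong n (f x) (f y + pz ^ n *s (D *v h))"
    by (rule pcong_mono[of "2 * n"]) (use assms(1) in \<open>simp_all add: h taylor_at_def\<close>)
  also have "pcong n \<dots> (f y)" by (auto simp: pcong_iff_ex)
  finally show ?thesis .
qed

lemma taylor_at_comp:
  assumes "taylor_at f x D" "taylor_at g (f x) D'"
  shows "taylor_at (g \<circ> f) x (D' ** D)"
  unfolding taylor_at_def
proof (intro allI)
  fix n h
  obtain r where "f (x + pz ^ n *s h) = f x + pz ^ n *s (D *v h) + pz ^ (2 * n) *s r"
    using assms(1) unfolding taylor_at_def pcong_iff_ex by blast
  then have r: "f (x + pz ^ n *s h) = f x + pz ^ n *s (D *v h + pz ^ n *s r)"
    by (simp add: vec_eq_iff algebra_simps mult_2_right flip: power_add)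
  have "pcong (2 * n) ((g \<circ> f) (x + pz ^ n *s h)) (g (f x) + pz ^ n *s (D' *v (D *v h + pz ^ n *s r)))"
    using assms(2) unfolding taylor_at_def comp_apply r by blast
  also have "pcong (2 * n) \<dots> (g (f x) + pz ^ n *s (D' *v (D *v h)))"
    unfolding mult_2 pcong_scaled by (intro pcong_matrix_vector_mult) (auto simp: pcong_iff_ex)
  finally show "pcong (2 * n) ((g \<circ> f) (x + pz ^ n *s h)) ((g \<circ> f) x + pz ^ n *s (D' ** D *v h))"
    by (simp add: matrix_vector_mul_assoc)
qed

definition taylor_map :: "('p::prime_card padic_int ^ 'd::finite \<Rightarrow> 'p padic_int ^ 'd) \<Rightarrow> bool" where
  "taylor_map f \<longleftrightarrow> (\<forall>x. \<exists>D. taylor_at f x D)"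

lemma taylor_map_funpow: "taylor_map f \<Longrightarrow> taylor_map (f ^^ k)"
proof (induction k)
  case 0
  have "taylor_at id x (mat 1)" for x :: "'a padic_int ^ 'b"
    by (simp add: taylor_at_def)
  then show ?case by (auto simp: taylor_map_def id_def)
next
  case (Suc k)
  then show ?case using taylor_at_comp unfolding taylor_map_def funpow.simps by blast
qed

lemma taylor_map_pcong: "taylor_map f \<Longrightarrow> pcong n x y \<Longrightarrow> pcong n (f x) (f y)"
  using taylor_at_pcong unfolding taylor_map_def by blast

text \<open>
  Congruent points have congruent derivatives, because the point
  \<open>x + p ^ n k = y + p ^ n (h + k)\<close>, where \<open>x = y + p ^ n h\<close>, can be expanded around \<open>x\<close> and around \<open>y\<close>, and the two expansions
  agree modulo \<open>p ^ (2 * n)\<close>.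
\<close>

lemma taylor_at_derivative_pcong:
  assumes "taylor_at f x D" "taylor_at f y D'" "pcong n x y"
  shows "pcong n (D *v k) (D' *v k)"
proof -
  obtain h where h: "x = y + pz ^ n *s h" using assms(3) pcong_iff_ex by blast
  have 1: "pcong (2 * n) (f x) (f y + pz ^ n *s (D' *v h))"
    using assms(2) by (simp add: h taylor_at_def)
  have "pcong (2 * n) (f (x + pz ^ n *s k)) (f x + pz ^ n *s (D *v k))"
    using assms(1) by (simp add: taylor_at_def)
  also have "pcong (2 * n) \<dots> (f y + pz ^ n *s (D' *v h) + pz ^ n *s (D *v k))"
    by (intro pcong_add 1) simp
  finally have 1: "pcong (2 * n) (f (x + pz ^ n *s k)) \<dots>" .
  have "pcong (2 * n) (f (y + pz ^ n *s (h + k))) (f y + pz ^ n *s (D' *v (h + k)))"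
    using assms(2) unfolding taylor_at_def by blast
  also have "y + pz ^ n *s (h + k) = x + pz ^ n *s k"
    by (simp add: h vec_eq_iff algebra_simps)
  also have "f y + pz ^ n *s (D' *v (h + k)) = f y + pz ^ n *s (D' *v h) + pz ^ n *s (D' *v k)"
    by (simp add: matrix_vector_right_distrib vector_add_ldistrib add.assoc)
  finally have 2: "pcong (2 * n) (f (x + pz ^ n *s k)) \<dots>" .
  have "pcong (n + n) (f y + pz ^ n *s (D' *v h) + pz ^ n *s (D *v k))
      (f y + pz ^ n *s (D' *v h) + pz ^ n *s (D' *v k))"
    using pcong_trans[OF pcong_sym[OF 1] 2] by (simp only: mult_2)
  then show ?thesis by (simp only: pcong_scaled)
qed

section \<open>An idempotent iterate\<close>

lemma finite_padic_reduce_image: "finite (padic_reduce n ` (A :: ('p::prime_card padic_int ^ 'd::finite) set))"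
proof (rule finite_subset)
  show "padic_reduce n ` A \<subseteq> {v :: int ^ 'd. \<forall>i. v $ i \<in> {0..<pp TYPE('p) n}}"
    by (auto simp: padic_reduce_def padic_residue_range)
  have "{v :: int ^ 'd. \<forall>i. v $ i \<in> {0..<pp TYPE('p) n}}
      \<subseteq> vec_lambda ` (UNIV \<rightarrow>\<^sub>E {0..<pp TYPE('p) n})"
  proof
    fix v :: "int ^ 'd"
    assume "v \<in> {v :: int ^ 'd. \<forall>i. v $ i \<in> {0..<pp TYPE('p) n}}"
    then show "v \<in> vec_lambda ` (UNIV \<rightarrow>\<^sub>E {0..<pp TYPE('p) n})"
      by (intro image_eqI[of _ _ "vec_nth v"]) (auto simp: PiE_def)
  qed
  then show "finite {v :: int ^ 'd. \<forall>i. v $ i \<in> {0..<pp TYPE('p) n}}"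
    by (rule finite_subset) (intro finite_imageI finite_PiE; simp)
qed

text \<open>
  The iterates of \<open>f\<close> induce only finitely many self-maps of the finite set of residues modulo
  \<open>p ^ n\<close>, so two of them coincide; from there on the induced maps repeat, and a multiple of the
  repetition length that lies beyond its start gives an idempotent.
\<close>

lemma exists_idempotent_iterate:
  assumes "taylor_map f"
  shows "\<exists>k>0. \<forall>x. pcong n ((f ^^ k) ((f ^^ k) x)) ((f ^^ k) x)"
proof -
  (* The induced self-map of the residues is represented by its graph, which lives in a finite set. *)
  define graph where "graph = (\<lambda>j. range (\<lambda>x. (padic_reduce n x, padic_reduce n ((f ^^ j) x))))"
  let ?A = "padic_reduce n ` (UNIV :: ('a padic_int ^ 'b) set)"
  have "range graph \<subseteq> Pow (?A \<times> ?A)" by (auto simp: graph_def)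
  then have "finite (range graph)"
    by (rule finite_subset) (intro finite_Pow_iff[THEN iffD2] finite_cartesian_product finite_padic_reduce_image)
  then have "\<not> inj graph" using finite_imageD infinite_UNIV_nat by blast
  then obtain i j where ij: "i < j" "graph i = graph j"
    unfolding inj_def by (metis linorder_neqE_nat)
  have same: "pcong n ((f ^^ j) x) ((f ^^ i) x)" for x
  proof -
    have "(padic_reduce n x, padic_reduce n ((f ^^ i) x)) \<in> graph j"
      unfolding ij(2)[symmetric] by (simp add: graph_def)
    then obtain y where y: "pcong n x y" "pcong n ((f ^^ i) x) ((f ^^ j) y)"
      by (auto simp: graph_def pcong_def)
    have "pcong n ((f ^^ j) x) ((f ^^ j) y)"
      using taylor_map_pcong[OF taylor_map_funpow[OF assms] y(1)] .
    also have "pcong n \<dots> ((f ^^ i) x)" using y(2) by (rule pcong_sym)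
    finally show ?thesis .
  qed
  have shift: "pcong n ((f ^^ (m + q * (j - i))) x) ((f ^^ m) x)" if "i \<le> m" for m q x
  proof (induction q)
    case (Suc q)
    define s where "s = m - i + q * (j - i)"
    have e: "m + Suc q * (j - i) = j + s" "m + q * (j - i) = i + s"
      using that ij(1) by (simp_all add: s_def)
    have "pcong n ((f ^^ (m + Suc q * (j - i))) x) ((f ^^ (m + q * (j - i))) x)"
      unfolding e funpow_add comp_def by (rule same)
    then show ?case using Suc.IH by (rule pcong_trans)
  qed simp
  (* The factor i + 1 only serves to make k at least i. *)
  define k where "k = (i + 1) * (j - i)"
  have "i \<le> k" "k > 0" using ij(1) by (cases "j - i"; simp add: k_def)+
  moreover have "pcong n ((f ^^ k) ((f ^^ k) x)) ((f ^^ k) x)" for x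
    using shift[OF \<open>i \<le> k\<close>, of "i + 1" x] unfolding k_def[symmetric] funpow_add comp_def .
  ultimately show ?thesis by blast
qed

section \<open>Linear drift near a fixed point\<close>

lemma funpow_funpow: "(f ^^ i) ((f ^^ j) x) = (f ^^ (i + j)) x"
  by (simp add: funpow_add)

locale idempotent_lift =
  fixes F :: "'p::prime_card padic_int ^ 'd::finite \<Rightarrow> 'p padic_int ^ 'd"
    and x1 :: "'p padic_int ^ 'd" and D :: "'p padic_int ^ 'd ^ 'd"
  assumes taylor: "taylor_map F"
    and fixed: "pcong 4 (F x1) x1"
    and deriv: "taylor_at F x1 D"
    and idem: "pcong 2 (D *v (D *v h)) (D *v h)"
begin

lemma funpow_pcong: "pcong n x y \<Longrightarrow> pcong n ((F ^^ j) x) ((F ^^ j) y)"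
  using taylor_map_pcong[OF taylor_map_funpow[OF taylor]] .

lemma funpow_near:
  assumes "pcong 2 x x1"
  shows "pcong 2 ((F ^^ j) x) x1"
proof (induction j)
  case (Suc j)
  have "pcong 2 (F ((F ^^ j) x)) (F x1)" using taylor_map_pcong[OF taylor Suc.IH] .
  also have "pcong 2 (F x1) x1" using pcong_mono[OF fixed] by simp
  finally show ?case by simp
qed (simp add: assms)

text \<open>
  The expansion is made with the fixed matrix \<open>D\<close>, although \<open>x\<close> is any point of the residue class
  of \<open>x1\<close> modulo \<open>p\<^sup>2\<close>: derivatives at such points agree modulo \<open>p\<^sup>2\<close>, which limits the precision to
  \<open>n + 2\<close> instead of \<open>2 * n\<close>.
\<close>

lemma expand_near:
  assumes "pcong 2 x x1" "2 \<le> n"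
  shows "pcong (n + 2) (F (x + pz ^ n *s h)) (F x + pz ^ n *s (D *v h))"
proof -
  obtain D' where D': "taylor_at F x D'" using taylor unfolding taylor_map_def by blast
  have "pcong (2 * n) (F (x + pz ^ n *s h)) (F x + pz ^ n *s (D' *v h))"
    using D' unfolding taylor_at_def by blast
  then have "pcong (n + 2) (F (x + pz ^ n *s h)) (F x + pz ^ n *s (D' *v h))"
    by (rule pcong_mono) (use assms(2) in simp)
  also have "pcong (n + 2) \<dots> (F x + pz ^ n *s (D *v h))"
    unfolding pcong_scaled using taylor_at_derivative_pcong[OF D' deriv assms(1)] .
  finally show ?thesis .
qed

lemma funpow_expand_near:
  assumes "pcong 2 x x1" "2 \<le> n" "0 < c"
  shows "pcong (n + 2) ((F ^^ c) (x + pz ^ n *s h)) ((F ^^ c) x + pz ^ n *s (D *v h))"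
  using assms(3)
proof (induction c rule: nat_induct_non_zero)
  case 1
  then show ?case using expand_near[OF assms(1,2)] by simp
next
  case (Suc c)
  have "pcong (n + 2) ((F ^^ Suc c) (x + pz ^ n *s h)) (F ((F ^^ c) x + pz ^ n *s (D *v h)))"
    using taylor_map_pcong[OF taylor Suc.IH] by simp
  also have "pcong (n + 2) \<dots> ((F ^^ Suc c) x + pz ^ n *s (D *v (D *v h)))"
    using expand_near[OF funpow_near[OF assms(1)] assms(2)] by simp
  also have "pcong (n + 2) \<dots> ((F ^^ Suc c) x + pz ^ n *s (D *v h))"
    unfolding pcong_scaled by (rule idem)
  finally show ?case .
qed

text \<open>
  The map \<open>F ^^ c\<close> acts on its orbit of \<open>y\<close> as the translation by \<open>p ^ n *s b\<close>, up to level \<open>n + 2\<close>, where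
  modulo \<open>p\<^sup>2\<close> the vector \<open>b\<close> lies in the image of the idempotent \<open>D\<close>. Precision \<open>n + 2\<close> allows the translation
  to be followed through \<open>p\<close> steps and still be known modulo \<open>p\<close> afterwards.
\<close>

definition drift :: "nat \<Rightarrow> nat \<Rightarrow> 'p padic_int ^ 'd \<Rightarrow> 'p padic_int ^ 'd \<Rightarrow> bool" where
  "drift n c y b \<longleftrightarrow> pcong 2 y x1 \<and> pcong 2 (D *v b) b \<and>
    (\<forall>i. pcong (n + 2) ((F ^^ (i * c)) y) (y + pz ^ n *s (of_nat i *s b)))"

text \<open>
  Near \<open>y\<close>, the map \<open>F ^^ c\<close> is \<open>y + p ^ n g \<longmapsto> y + p ^ n (D a + D g)\<close>. All multiples of \<open>b = D a\<close> are
  fixed by \<open>D\<close> modulo \<open>p\<^sup>2\<close>, so repeated application adds \<open>b\<close> each time. Starting at \<open>y\<close> rather than at \<open>x\<close>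
  removes the component of \<open>a\<close> in the kernel of \<open>D\<close>.
\<close>

lemma drift_start:
  assumes x: "pcong 2 x x1" and n: "2 \<le> n" and c: "0 < c"
    and a: "(F ^^ c) x = x + pz ^ n *s a"
  shows "drift n c ((F ^^ c) x) (D *v a)"
proof -
  define y where "y = (F ^^ c) x"
  define b where "b = D *v a"
  have y: "pcong 2 y x1" unfolding y_def by (rule funpow_near[OF x])
  have Db: "pcong 2 (D *v b) b" unfolding b_def by (rule idem)
  have once: "pcong (n + 2) ((F ^^ c) y) (y + pz ^ n *s b)"
    using funpow_expand_near[OF x n c, of a] unfolding y_def b_def a .
  have "pcong (n + 2) ((F ^^ (i * c)) y) (y + pz ^ n *s (of_nat i *s b))" for i
  proof (induction i)
    case (Suc i)
    have "pcong (n + 2) ((F ^^ (Suc i * c)) y) ((F ^^ c) (y + pz ^ n *s (of_nat i *s b)))"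
      using funpow_pcong[OF Suc.IH, of c] by (simp add: funpow_add)
    also have "pcong (n + 2) \<dots> ((F ^^ c) y + pz ^ n *s (D *v (of_nat i *s b)))"
      by (rule funpow_expand_near[OF y n c])
    also have "pcong (n + 2) \<dots> ((F ^^ c) y + pz ^ n *s (of_nat i *s b))"
      unfolding pcong_scaled matrix_vector_scale by (rule pcong_scale[OF Db])
    also have "pcong (n + 2) \<dots> (y + pz ^ n *s b + pz ^ n *s (of_nat i *s b))"
      by (intro pcong_add once pcong_refl)
    also have "y + pz ^ n *s b + pz ^ n *s (of_nat i *s b) = y + pz ^ n *s (of_nat (Suc i) *s b)"
      by (simp add: vec_eq_iff algebra_simps)
    finally show ?case .
  qed simp
  then show ?thesis using y Db unfolding drift_def y_def b_def by blast
qed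

text \<open>
  After \<open>p\<close> steps the translation by \<open>p ^ n b\<close> has become one by \<open>p ^ (n + 1) b\<close>, still known
  modulo \<open>p ^ (n + 2)\<close>. Restarting there restores the precision and changes \<open>b\<close> only by multiples of \<open>p\<close>.
\<close>

lemma drift_lift:
  assumes dr: "drift n c y b" and n: "2 \<le> n" and c: "0 < c"
  shows "\<exists>b'. drift (Suc n) (CARD('p) * c) ((F ^^ (CARD('p) * c)) y) b' \<and> pcong 1 b' b"
proof -
  have "pcong (n + 2) ((F ^^ (CARD('p) * c)) y) (y + pz ^ n *s (pz *s b))"
    using dr unfolding drift_def by blast
  also have "y + pz ^ n *s (pz *s b) = y + pz ^ Suc n *s b"
    by (simp add: vec_eq_iff algebra_simps)
  finally have 1: "pcong (Suc n + 1) ((F ^^ (CARD('p) * c)) y) (y + pz ^ Suc n *s b)" by simp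
  then have "pcong (Suc n) ((F ^^ (CARD('p) * c)) y) (y + pz ^ Suc n *s b)"
    by (rule pcong_mono) simp
  also have "pcong (Suc n) \<dots> y" unfolding pcong_iff_ex by blast
  finally obtain a where a: "(F ^^ (CARD('p) * c)) y = y + pz ^ Suc n *s a"
    unfolding pcong_iff_ex by blast
  have ab: "pcong 1 a b" using 1 unfolding a pcong_scaled .
  have "pcong 1 (D *v a) (D *v b)" by (rule pcong_matrix_vector_mult[OF ab])
  also have "pcong 1 \<dots> b"
    by (rule pcong_mono[of 2]) (use dr in \<open>simp_all add: drift_def\<close>)
  finally have "pcong 1 (D *v a) b" .
  moreover have "drift (Suc n) (CARD('p) * c) ((F ^^ (CARD('p) * c)) y) (D *v a)"
    by (rule drift_start[OF _ _ _ a]) (use dr n c in \<open>simp_all add: drift_def\<close>)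
  ultimately show ?thesis by blast
qed

lemma drift_period: "drift n c y b \<Longrightarrow> pcong n ((F ^^ c) y) y"
proof -
  assume "drift n c y b"
  then have "pcong (n + 2) ((F ^^ (1 * c)) y) (y + pz ^ n *s (of_nat 1 *s b))"
    unfolding drift_def by blast
  then have "pcong n ((F ^^ c) y) (y + pz ^ n *s b)" by (auto elim: pcong_mono)
  also have "pcong n \<dots> y" unfolding pcong_iff_ex by blast
  finally show ?thesis .
qed

text \<open>
  Each passage to the next level waits for one full period, so the starting time \<open>t\<close> is at most
  \<open>t0\<close> plus the sum of the periods \<open>p ^ 1, \<dots>, p ^ m\<close>. The crude bound \<open>m * p ^ m\<close> suffices because a
  polynomial factor does not affect the dimension.
\<close>

lemma drift_persists:
  assumes "drift n0 1 ((F ^^ t0) x1) b0" "\<not> pcong 1 b0 0" "2 \<le> n0"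
  shows "\<exists>t b. t \<le> t0 + m * CARD('p) ^ m \<and> drift (n0 + m) (CARD('p) ^ m) ((F ^^ t) x1) b \<and> \<not> pcong 1 b 0"
proof (induction m)
  case 0
  then show ?case using assms by auto
next
  case (Suc m)
  let ?p = "CARD('p)"
  obtain t b where t: "t \<le> t0 + m * ?p ^ m" and dr: "drift (n0 + m) (?p ^ m) ((F ^^ t) x1) b"
    and b: "\<not> pcong 1 b 0" using Suc.IH by blast
  obtain b' where dr': "drift (Suc (n0 + m)) (?p * ?p ^ m) ((F ^^ (?p * ?p ^ m)) ((F ^^ t) x1)) b'"
    and b': "pcong 1 b' b"
    using drift_lift[OF dr] assms(3) by auto
  have "t + ?p ^ Suc m \<le> t0 + Suc m * ?p ^ Suc m"
  proof -
    have "m * ?p ^ m \<le> m * ?p ^ Suc m"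
      by (intro mult_le_mono2 power_increasing) simp_all
    then show ?thesis using t by (simp only: mult_Suc)
  qed
  moreover have "drift (n0 + Suc m) (?p ^ Suc m) ((F ^^ (t + ?p ^ Suc m)) x1) b'"
    using dr' by (simp add: funpow_funpow add.commute)
  moreover have "\<not> pcong 1 b' 0"
    using b b' pcong_sym pcong_trans by blast
  ultimately show ?case by blast
qed

text \<open>
  Suppose the times \<open>i\<close> and \<open>j\<close> agree at level \<open>n0 + m + 1\<close> and differ by \<open>p ^ m * l\<close>. Moving both far enough
  along the orbit brings them into the range where level \<open>n0 + m\<close> is a translation by \<open>b\<close> per \<open>p ^ m\<close> steps;
  there they differ by \<open>l b\<close>, and since \<open>b\<close> is nonzero modulo \<open>p\<close>, the prime \<open>p\<close> divides \<open>l\<close>.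
\<close>

lemma drift_separates:
  assumes dr0: "drift n0 1 ((F ^^ t0) x1) b0" "\<not> pcong 1 b0 0" "2 \<le> n0"
    and "i \<le> j" "pcong (n0 + m) ((F ^^ i) x1) ((F ^^ j) x1)"
  shows "CARD('p) ^ m dvd j - i"
  using assms(5)
proof (induction m)
  case (Suc m)
  let ?p = "CARD('p)"
  have "pcong (n0 + m) ((F ^^ i) x1) ((F ^^ j) x1)"
    by (rule pcong_mono[OF Suc.prems]) simp
  then obtain l where l: "j - i = ?p ^ m * l" using Suc.IH by (auto simp: dvd_def)
  obtain t b where dr: "drift (n0 + m) (?p ^ m) ((F ^^ t) x1) b" and b: "\<not> pcong 1 b 0"
    using drift_persists[OF dr0] by blast
  define y where "y = (F ^^ t) x1"
  have orbit: "pcong (n0 + Suc m) ((F ^^ (s * ?p ^ m)) y) (y + pz ^ (n0 + m) *s (of_nat s *s b))" for s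
    by (rule pcong_mono[of "n0 + m + 2"]) (use dr in \<open>simp_all add: drift_def y_def\<close>)
  define s where "s = t + i * ?p ^ m"
  have "i \<le> s" by (simp add: s_def trans_le_add2)
  have e1: "(F ^^ (s - i)) ((F ^^ i) x1) = (F ^^ (i * ?p ^ m)) y"
    unfolding y_def funpow_funpow using \<open>i \<le> s\<close> by (simp add: s_def add.commute)
  have e: "s - i + j = (i + l) * ?p ^ m + t"
    using \<open>i \<le> s\<close> \<open>i \<le> j\<close> l by (simp add: s_def algebra_simps)
  have e2: "(F ^^ (s - i)) ((F ^^ j) x1) = (F ^^ ((i + l) * ?p ^ m)) y"
    unfolding y_def funpow_funpow e ..
  have "pcong (n0 + Suc m) (y + pz ^ (n0 + m) *s (of_nat i *s b)) ((F ^^ (i * ?p ^ m)) y)"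
    by (rule pcong_sym[OF orbit])
  also have "pcong (n0 + Suc m) \<dots> ((F ^^ ((i + l) * ?p ^ m)) y)"
    using funpow_pcong[OF Suc.prems, of "s - i"] unfolding e1 e2 .
  also have "pcong (n0 + Suc m) \<dots> (y + pz ^ (n0 + m) *s (of_nat (i + l) *s b))"
    by (rule orbit)
  finally have "pcong (n0 + m + 1) (y + pz ^ (n0 + m) *s (of_nat i *s b))
      (y + pz ^ (n0 + m) *s (of_nat (i + l) *s b))" by simp
  then have "pcong 1 (of_nat (i + l) *s b) (of_nat i *s b)"
    unfolding pcong_scaled by (rule pcong_sym)
  then have "pz dvd of_nat l * b $ r" for r
    by (simp add: pcong_iff_dvd algebra_simps)
  moreover obtain r where "\<not> pz dvd b $ r" using b by (auto simp: pcong_iff_dvd)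
  ultimately have "?p dvd l" using pz_dvd_of_nat_mult by blast
  then show ?case unfolding l by (simp add: mult.commute)
qed simp

text \<open>
  Consider the first \<open>n\<close> such that the orbit modulo \<open>p ^ n\<close> is not constant from time \<open>n\<close> on. At the level
  before it the orbit does become constant, so \<open>drift_start\<close> applies there, and a translation vector
  divisible by \<open>p\<close> would make the orbit constant modulo \<open>p ^ n\<close> as well.
\<close>

lemma drift_or_converges:
  "(\<forall>n. pcong n ((F ^^ Suc n) x1) ((F ^^ n) x1)) \<or>
   (\<exists>n0 b. 2 \<le> n0 \<and> drift n0 1 ((F ^^ Suc n0) x1) b \<and> \<not> pcong 1 b 0)"
proof (cases "\<forall>n. pcong n ((F ^^ Suc n) x1) ((F ^^ n) x1)")
  case False
  then have ex: "\<exists>n. \<not> pcong n ((F ^^ Suc n) x1) ((F ^^ n) x1)" by blast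
  define n where "n = (LEAST n. \<not> pcong n ((F ^^ Suc n) x1) ((F ^^ n) x1))"
  have bad: "\<not> pcong n ((F ^^ Suc n) x1) ((F ^^ n) x1)"
    using LeastI_ex[OF ex] by (simp add: n_def)
  have good: "pcong k ((F ^^ Suc k) x1) ((F ^^ k) x1)" if "k < n" for k
    using not_less_Least[of k] that unfolding n_def by blast
  have "pcong 4 ((F ^^ n) (F x1)) ((F ^^ n) x1)" by (rule funpow_pcong[OF fixed])
  (* Period 1 holds modulo p^4 from the start, so the failure leaves n0 >= 2 as drift_start requires. *)
  then have "4 < n" using bad pcong_mono[of 4 _ _ n] by (metis funpow_swap1 funpow.simps(2) comp_apply not_less)
  then obtain n0 where n0: "n = Suc n0" "2 \<le> n0" by (cases n) auto
  obtain a where a: "F ((F ^^ n0) x1) = (F ^^ n0) x1 + pz ^ n0 *s a"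
    using good[of n0] n0(1) unfolding pcong_iff_ex by auto
  have "drift n0 1 ((F ^^ 1) ((F ^^ n0) x1)) (D *v a)"
    by (rule drift_start) (use a n0 funpow_near[OF pcong_refl] in simp_all)
  then have dr: "drift n0 1 ((F ^^ n) x1) (D *v a)" by (simp add: n0(1))
  have "\<not> pcong 1 (D *v a) 0"
  proof
    assume 0: "pcong 1 (D *v a) 0"
    have "pcong (n0 + 2) ((F ^^ (1 * 1)) ((F ^^ n) x1)) ((F ^^ n) x1 + pz ^ n0 *s (of_nat 1 *s (D *v a)))"
      using dr unfolding drift_def by blast
    then have "pcong (n0 + 1) ((F ^^ Suc n) x1) ((F ^^ n) x1 + pz ^ n0 *s (D *v a))"
      by (auto elim: pcong_mono)
    also have "pcong (n0 + 1) \<dots> ((F ^^ n) x1 + pz ^ n0 *s 0)"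
      unfolding pcong_scaled by (rule 0)
    finally show False using bad n0(1) by simp
  qed
  then show ?thesis using dr n0 by blast
qed blast

end

text \<open>
  For \<open>z = x1 + p\<^sup>2 h\<close>, expansion gives \<open>F z \<equiv> x1 + p\<^sup>2 D h\<close> and \<open>F (F z) \<equiv> x1 + p\<^sup>2 D (D h)\<close> modulo \<open>p ^ 4\<close>.
  The two agree since \<open>F\<close> is idempotent modulo \<open>p ^ 4\<close>, and cancelling \<open>p\<^sup>2\<close> gives the idempotence of \<open>D\<close>.
\<close>

lemma taylor_map_idempotent_lift:
  fixes F :: "'p::prime_card padic_int ^ 'd::finite \<Rightarrow> 'p padic_int ^ 'd"
  assumes F: "taylor_map F" and idem: "\<And>x. pcong 4 (F (F x)) (F x)"
  shows "\<exists>D. idempotent_lift F (F x0) D"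
proof -
  define x1 where "x1 = F x0"
  have x1: "pcong 4 (F x1) x1" unfolding x1_def by (rule idem)
  obtain D where D: "taylor_at F x1 D" using F unfolding taylor_map_def by blast
  have lin: "pcong 4 (F (x1 + pz ^ 2 *s h)) (x1 + pz ^ 2 *s (D *v h))" for h
  proof -
    have "pcong (2 * 2) (F (x1 + pz ^ 2 *s h)) (F x1 + pz ^ 2 *s (D *v h))"
      using D unfolding taylor_at_def by blast
    then have "pcong 4 (F (x1 + pz ^ 2 *s h)) (F x1 + pz ^ 2 *s (D *v h))" by simp
    also have "pcong 4 \<dots> (x1 + pz ^ 2 *s (D *v h))" by (intro pcong_add x1 pcong_refl)
    finally show ?thesis .
  qed
  have "pcong 2 (D *v (D *v h)) (D *v h)" for h
  proof -
    let ?z = "x1 + pz ^ 2 *s h"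
    have "pcong 4 (x1 + pz ^ 2 *s (D *v (D *v h))) (F (x1 + pz ^ 2 *s (D *v h)))"
      by (rule pcong_sym[OF lin])
    also have "pcong 4 \<dots> (F (F ?z))" by (rule taylor_map_pcong[OF F pcong_sym[OF lin]])
    also have "pcong 4 \<dots> (F ?z)" by (rule idem)
    also have "pcong 4 \<dots> (x1 + pz ^ 2 *s (D *v h))" by (rule lin)
    finally have "pcong (2 + 2) (x1 + pz ^ 2 *s (D *v (D *v h))) (x1 + pz ^ 2 *s (D *v h))" by simp
    then show ?thesis by (simp only: pcong_scaled)
  qed
  then have "idempotent_lift F x1 D" using F x1 D by unfold_locales
  then show ?thesis unfolding x1_def ..
qed

section \<open>Counting the orbit modulo powers of p\<close>

lemma card_orbit_le:
  assumes f: "taylor_map f" and per: "pcong n ((f ^^ (a + b)) x) ((f ^^ a) x)" and b: "0 < b"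
  shows "card (padic_reduce n ` range (\<lambda>j. (f ^^ j) x)) \<le> a + b"
proof -
  have "padic_reduce n ((f ^^ j) x) \<in> (\<lambda>j. padic_reduce n ((f ^^ j) x)) ` {..<a + b}" for j
  proof (induction j rule: less_induct)
    case (less j)
    show ?case
    proof (cases "j < a + b")
      case False
      then obtain r where r: "j = r + (a + b)" by (metis add.commute le_Suc_ex not_less)
      have "pcong n ((f ^^ j) x) ((f ^^ (r + a)) x)"
        using taylor_map_pcong[OF taylor_map_funpow[OF f] per, of r]
        by (simp add: r funpow_add)
      then show ?thesis using less.IH[of "r + a"] b by (simp add: r pcong_def)
    qed simp
  qed
  then have "padic_reduce n ` range (\<lambda>j. (f ^^ j) x) \<subseteq> (\<lambda>j. padic_reduce n ((f ^^ j) x)) ` {..<a + b}"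
    by blast
  then have "card (padic_reduce n ` range (\<lambda>j. (f ^^ j) x))
      \<le> card ((\<lambda>j. padic_reduce n ((f ^^ j) x)) ` {..<a + b})"
    by (intro card_mono) simp_all
  also have "\<dots> \<le> a + b"
    using card_image_le[of "{..<a + b}" "\<lambda>j. padic_reduce n ((f ^^ j) x)"] by simp
  finally show ?thesis .
qed

text \<open>
  A point of the \<open>F\<close>-orbit of \<open>x1\<close> at time \<open>j\<close> is the point of the \<open>f\<close>-orbit of \<open>x0\<close> at time
  \<open>k * (j + 1)\<close>, so passing between the two orbits costs at most a constant factor. A coincidence
  between two times bounds the count from above (\<open>card_orbit_le\<close>), and \<open>drift_separates\<close> makes the first
  \<open>p ^ m\<close> points distinct at level \<open>n0 + m\<close>.
\<close>

lemma orbit_count_dichotomy: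
  fixes f :: "'p::prime_card padic_int ^ 'd::finite \<Rightarrow> 'p padic_int ^ 'd"
    and x0 :: "'p padic_int ^ 'd"
  assumes f: "taylor_map f"
  defines "N \<equiv> \<lambda>n. card (padic_reduce n ` range (\<lambda>j. (f ^^ j) x0))"
  shows "(\<exists>K. \<forall>n. N n \<le> K * (n + 1)) \<or>
    (\<exists>K n0. \<forall>m. CARD('p) ^ m \<le> N (n0 + m) \<and> N (n0 + m) \<le> K * (m + 1) * CARD('p) ^ m)"
proof -
  let ?p = "CARD('p)"
  obtain k where k: "0 < k" "\<And>x. pcong 4 ((f ^^ k) ((f ^^ k) x)) ((f ^^ k) x)"
    using exists_idempotent_iterate[OF f] by blast
  define F where "F = f ^^ k"
  define x1 where "x1 = F x0"
  obtain D where "idempotent_lift F x1 D"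
    using taylor_map_idempotent_lift[OF taylor_map_funpow[OF f] k(2)] unfolding F_def x1_def by blast
  then interpret idempotent_lift F x1 D .
  have F_orbit: "(F ^^ j) x1 = (f ^^ (k * Suc j)) x0" for j
    by (simp add: F_def x1_def funpow_mult funpow_funpow add.commute)
  have N_le: "N n \<le> k * Suc t + k * c" if "pcong n ((F ^^ (t + c)) x1) ((F ^^ t) x1)" "0 < c" for n t c
  proof -
    have "pcong n ((f ^^ (k * Suc t + k * c)) x0) ((f ^^ (k * Suc t)) x0)"
      using that(1) unfolding F_orbit by (simp add: algebra_simps)
    then show ?thesis unfolding N_def by (rule card_orbit_le[OF f]) (use that(2) k(1) in simp)
  qed
  from drift_or_converges show ?thesis
  proof (elim disjE exE conjE)
    assume conv: "\<forall>n. pcong n ((F ^^ Suc n) x1) ((F ^^ n) x1)"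
    have "N n \<le> (2 * k) * (n + 1)" for n
    proof -
      have "N n \<le> k * Suc n + k * 1" by (rule N_le) (use conv in simp_all)
      then show ?thesis by (simp add: algebra_simps)
    qed
    then show ?thesis by blast
  next
    fix n0 b0 assume dr0: "2 \<le> n0" "drift n0 1 ((F ^^ Suc n0) x1) b0" "\<not> pcong 1 b0 0"
    have "N (n0 + m) \<le> k * (n0 + 3) * (m + 1) * ?p ^ m" for m
    proof -
      obtain t b where t: "t \<le> Suc n0 + m * ?p ^ m" and dr: "drift (n0 + m) (?p ^ m) ((F ^^ t) x1) b"
        using drift_persists[OF dr0(2,3,1)] by blast
      have "pcong (n0 + m) ((F ^^ (t + ?p ^ m)) x1) ((F ^^ t) x1)"
        using drift_period[OF dr] by (simp add: funpow_add add.commute[of t])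
      then have "N (n0 + m) \<le> k * Suc t + k * ?p ^ m" by (rule N_le) simp
      also have "\<dots> = k * (Suc t + ?p ^ m)" by (simp add: algebra_simps)
      finally have N: "N (n0 + m) \<le> k * (Suc t + ?p ^ m)" .
      have "Suc t + ?p ^ m \<le> (n0 + 2) * 1 + (m + 1) * ?p ^ m" using t by simp
      also have "\<dots> \<le> (n0 + 2) * ((m + 1) * ?p ^ m) + (m + 1) * ?p ^ m"
        by (intro add_mono mult_le_mono2 order_refl) (simp add: Suc_le_eq)
      also have "\<dots> = (n0 + 3) * ((m + 1) * ?p ^ m)" by (simp add: algebra_simps)
      finally have "k * (Suc t + ?p ^ m) \<le> k * ((n0 + 3) * ((m + 1) * ?p ^ m))"
        by (rule mult_le_mono2)
      then show ?thesis using N by (simp only: mult.assoc)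
    qed
    moreover have "?p ^ m \<le> N (n0 + m)" for m
    proof -
      let ?g = "\<lambda>j. padic_reduce (n0 + m) ((F ^^ j) x1)"
      have eq: "i = j" if "i \<le> j" "j < ?p ^ m" "?g i = ?g j" for i j
      proof -
        have "?p ^ m dvd j - i"
          using drift_separates[OF dr0(2,3,1) that(1)] that(3) by (simp add: pcong_def)
        then show ?thesis using that(1,2) by (auto dest: dvd_imp_le)
      qed
      have "inj_on ?g {..<?p ^ m}"
      proof (rule inj_onI)
        fix i j assume "i \<in> {..<?p ^ m}" "j \<in> {..<?p ^ m}" "?g i = ?g j"
        then show "i = j" using eq[of i j] eq[of j i] by (cases "i \<le> j") auto
      qed
      then have "?p ^ m = card (?g ` {..<?p ^ m})" by (simp add: card_image)
      also have "\<dots> \<le> N (n0 + m)"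
        unfolding N_def F_orbit by (intro card_mono finite_padic_reduce_image) auto
      finally show ?thesis .
    qed
    ultimately show ?thesis by blast
  qed
qed

section \<open>Box dimension of the orbit closure\<close>

text \<open>
  Points at distance less than \<open>p ^ (- n)\<close> have the same reduction modulo \<open>p ^ n\<close>, so taking the closure
  adds no residue classes.
\<close>

lemma padic_reduce_closure: "padic_reduce n ` closure A = padic_reduce n ` A"
  for A :: "('p::prime_card padic_int ^ 'd::finite) set"
proof
  show "padic_reduce n ` closure A \<subseteq> padic_reduce n ` A"
  proof
    fix v assume "v \<in> padic_reduce n ` closure A"
    then obtain x where x: "x \<in> closure A" "v = padic_reduce n x" by blast
    have "0 < inverse (real CARD('p) ^ n)" by simp
    then obtain y where y: "y \<in> A" "dist y x < inverse (real CARD('p) ^ n)"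
      using x(1) unfolding closure_approachable by blast
    have "pcong n y x"
      unfolding pcong_iff_dvd
    proof
      fix i
      have "padic_abs (y $ i - x $ i) < inverse (real CARD('p) ^ n)"
        using dist_vec_nth_le[of y i x] y(2) by (simp add: dist_padic_int_def)
      then show "pz ^ n dvd y $ i - x $ i"
        using padic_abs_le_iff[of "y $ i - x $ i" n] by (simp add: padic_residue_eq_0_iff_dvd)
    qed
    then have "v = padic_reduce n y" using x(2) by (simp add: pcong_def)
    then show "v \<in> padic_reduce n ` A" using y(1) by blast
  qed
qed (use closure_subset in blast)

theorem theorem2:
  fixes f :: "'p::prime_card padic_int ^ 'd::finite \<Rightarrow> 'p padic_int ^ 'd"
    and x0 :: "'p padic_int ^ 'd"
    and E :: "('p padic_int ^ 'd) set"
  assumes "polynomial_map f"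
    and "E = closure {(f ^^ j) x0 | j. True}"
  shows "box_dim_exists E \<and> box_dim E \<in> {0, 1}"
proof -
  define N where "N = (\<lambda>n. card (padic_reduce n ` range (\<lambda>j. (f ^^ j) x0)))"
  define L where "L = ln (real CARD('p))"
  have L: "0 < L" using CARD_gt_1[where 'p = 'p] by (simp add: L_def)
  have "{(f ^^ j) x0 | j. True} = range (\<lambda>j. (f ^^ j) x0)" by auto
  then have q: "box_quotient E n = ln (real (N n)) / (real n * L)" for n
    unfolding box_quotient_def assms(2) padic_reduce_closure N_def L_def by simp
  have N_pos: "1 \<le> N n" for n
  proof -
    have "0 < N n" unfolding N_def by (simp add: card_gt_0_iff finite_padic_reduce_image)
    then show ?thesis by simp
  qed
  have "taylor_map f"
    using polynomial_map_taylor_at[OF assms(1)] by (simp add: taylor_map_def)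
  then consider (slow) K where "\<And>n. N n \<le> K * (n + 1)"
    | (fast) K n0 where "\<And>m. CARD('p) ^ m \<le> N (n0 + m)" "\<And>m. N (n0 + m) \<le> K * (m + 1) * CARD('p) ^ m"
    using orbit_count_dichotomy[of f x0] unfolding N_def by blast
  then have "box_quotient E \<longlonglongrightarrow> 0 \<or> box_quotient E \<longlonglongrightarrow> 1"
  proof cases
    case slow
    define c where "c = real K"
    have c: "0 < c" using slow[of 0] N_pos[of 0] by (simp add: c_def)
    have "(\<lambda>n. box_quotient E n) \<longlonglongrightarrow> 0"
    proof (rule tendsto_sandwich[OF always_eventually always_eventually tendsto_const])
      show "\<forall>n. 0 \<le> box_quotient E n"
        using N_pos L by (simp add: q)
      show "\<forall>n. box_quotient E n \<le> ln (c * (real n + 1)) / (real n * L)"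
      proof
        fix n
        have "real (N n) \<le> real (K * (n + 1))" using slow by (simp only: of_nat_le_iff)
        then have "ln (real (N n)) \<le> ln (c * (real n + 1))"
          using N_pos[of n] by (intro ln_mono) (simp_all add: c_def algebra_simps)
        then show "box_quotient E n \<le> ln (c * (real n + 1)) / (real n * L)"
          unfolding q using L by (intro divide_right_mono) simp_all
      qed
      show "(\<lambda>n. ln (c * (real n + 1)) / (real n * L)) \<longlonglongrightarrow> 0"
        using c L by real_asymp
    qed
    then show ?thesis by simp
  next
    case fast
    define c where "c = real K"
    have c: "0 < c" using fast[of 0] N_pos[of n0] by (cases K) (simp_all add: c_def)
    have "(\<lambda>m. box_quotient E (n0 + m)) \<longlonglongrightarrow> 1"
    proof (rule tendsto_sandwich[OF always_eventually always_eventually])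
      show "\<forall>m. real m * L / ((real n0 + real m) * L) \<le> box_quotient E (n0 + m)"
      proof
        fix m
        have "real (CARD('p) ^ m) \<le> real (N (n0 + m))" using fast(1) by (simp only: of_nat_le_iff)
        then have "ln (real CARD('p) ^ m) \<le> ln (real (N (n0 + m)))"
          using N_pos[of "n0 + m"] by (intro ln_mono) simp_all
        then have "real m * L \<le> ln (real (N (n0 + m)))" by (simp add: ln_realpow L_def)
        then show "real m * L / ((real n0 + real m) * L) \<le> box_quotient E (n0 + m)"
          unfolding q of_nat_add using L by (intro divide_right_mono) simp_all
      qed
      show "\<forall>m. box_quotient E (n0 + m)
          \<le> (ln c + ln (real m + 1) + real m * L) / ((real n0 + real m) * L)"
      proof
        fix m
        have "real (N (n0 + m)) \<le> real (K * (m + 1) * CARD('p) ^ m)"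
          using fast(2) by (simp only: of_nat_le_iff)
        then have "ln (real (N (n0 + m))) \<le> ln (c * (real m + 1) * real CARD('p) ^ m)"
          using N_pos[of "n0 + m"] c by (intro ln_mono) (simp_all add: c_def algebra_simps)
        also have "\<dots> = ln c + ln (real m + 1) + real m * L"
          using c by (simp add: ln_mult ln_realpow L_def)
        finally show "box_quotient E (n0 + m)
            \<le> (ln c + ln (real m + 1) + real m * L) / ((real n0 + real m) * L)"
          unfolding q of_nat_add using L by (intro divide_right_mono) simp_all
      qed
      show "(\<lambda>m. real m * L / ((real n0 + real m) * L)) \<longlonglongrightarrow> 1"
        using L by real_asymp
      show "(\<lambda>m. (ln c + ln (real m + 1) + real m * L) / ((real n0 + real m) * L)) \<longlonglongrightarrow> 1"
        using L by real_asymp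
    qed
    then have "box_quotient E \<longlonglongrightarrow> 1"
      using LIMSEQ_offset[of "box_quotient E" n0 1] by (simp add: add.commute)
    then show ?thesis by simp
  qed
  then show ?thesis
    unfolding box_dim_exists_def box_dim_def by (auto simp: convergent_def limI)
qed

end
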